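(* Let $\Pi$ and $\Pi'$ be two problems, $\varphi$ a length-preserving polynomial-time isomorphism from $\Pi$ to $\Pi'$ with output pullback $\psi$, $\mathrm{dist}$ a metric on the inputs of $\Pi$, and $\mathrm{dist}'$ a metric on the inputs of $\Pi'$ such that for every pair of inputs $I,J$ of $\Pi$, $\mathrm{dist}(I,J)=\mathrm{dist}'(\varphi(I),\varphi(J))$. Then for any map $d$, if $\mathrm{Rel}(\Pi',\mathrm{dist}',d)$ is in FP, then $\mathrm{Rel}(\Pi,\mathrm{dist},d)$ is in FP.
   Context: For a problem $\Pi$ (decision or function problem; for a function problem, $\mathrm{sol}_\Pi(J)$ denotes the set of correct solutions on $J$, including the symbol $\mathrm{nil}$ meaning no solution exists), a metric $\mathrm{dist}$ on its inputs, and a non-decreasing function $d:\mathbb N\to\mathbb R_+\cup\{\infty\}$, the function problem $\mathrm{Rel}(\Pi,\mathrm{dist},d)$ is: given an input $I$ of $\Pi$, output a pair $(J,\Pi(J))$ where $J$ is an input of $\Pi$ with $\mathrm{dist}(I,J)\le d(|I|)$ and $\Pi(J)\in\mathrm{sol}_\Pi(J)$ is a correct answer to $\Pi$ on $J$; here $|I|\in\mathbb N$ is the size of input $I$. A polynomial-time isomorphism $\varphi$ from $\Pi$ to $\Pi'$ is a bijection from the inputs of $\Pi$ to the inputs of $\Pi'$ that is computable in polynomial time, whose inverse $\varphi^{-1}$ is computable in polynomial time, and which comes with a polynomial-time computable function $\psi$ (the output pullback) such that for every input $I$ of $\Pi$ and every $x\in\mathrm{sol}_{\Pi'}(\varphi(I))$,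 $\psi(x)\in\mathrm{sol}_\Pi(I)$ (for decision problems $\psi$ maps true to true and false to false). $\varphi$ is length-preserving if $|\varphi(I)|=|I|$ for every input $I$ of $\Pi$. FP is the class of function problems solvable in polynomial time. *)

theory Defs
  imports "HOL-Analysis.Analysis" "HOL-Computational_Algebra.Polynomial"
begin

section \<open>Polynomial-time computability\<close>

type_synonym word = "bool list"

datatype move = MoveLeft | Stay | MoveRight

text \<open>
  Deterministic multi-tape Turing machines. The non-halting states are \<open>0, \<dots>, states M - 1\<close>, with
  start state \<open>0\<close>; the only halting state is the number \<open>states M\<close> itself. The tape alphabet is
  \<open>{0, \<dots>, alphabet M - 1}\<close>, where \<open>0\<close> is the blank and \<open>1\<close>, \<open>2\<close> represent the two bits.
  The transition function maps a state and the list of scanned symbols to the next state and,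
  for each tape, the symbol to be written and the head movement.
\<close>

record tm =
  tapes :: nat
  alphabet :: nat
  states :: nat
  delta :: "nat \<Rightarrow> nat list \<Rightarrow> nat \<times> (nat \<times> move) list"

definition wf_tm :: "tm \<Rightarrow> bool" where
  "wf_tm M \<longleftrightarrow> tapes M \<ge> 2 \<and> alphabet M \<ge> 3 \<and> states M \<ge> 1 \<and>
     (\<forall>q<states M. \<forall>ss. length ss = tapes M \<and> set ss \<subseteq> {..<alphabet M} \<longrightarrow>
        (case delta M q ss of (q', acts) \<Rightarrow>
           q' \<le> states M \<and> length acts = tapes M \<and> (\<forall>(s, m)\<in>set acts. s < alphabet M)))"

text \<open>A tape is infinite in both directions; it is given by its contents and the head position.\<close>

type_synonym tape = "(int \<Rightarrow> nat) \<times> int"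

type_synonym config = "nat \<times> tape list"

definition scanned :: "tape \<Rightarrow> nat" where
  "scanned t = fst t (snd t)"

fun shift :: "move \<Rightarrow> int \<Rightarrow> int" where
  "shift MoveLeft h = h - 1"
| "shift Stay h = h"
| "shift MoveRight h = h + 1"

fun act :: "tape \<Rightarrow> nat \<times> move \<Rightarrow> tape" where
  "act (c, h) (s, m) = (c(h := s), shift m h)"

definition step :: "tm \<Rightarrow> config \<Rightarrow> config" where
  "step M cf = (case cf of (q, ts) \<Rightarrow>
     if q < states M
     then (case delta M q (map scanned ts) of (q', acts) \<Rightarrow> (q', map2 act ts acts))
     else (q, ts))"

definition word_tape :: "word \<Rightarrow> tape" where
  "word_tape w =
     ((\<lambda>i. if 0 \<le> i \<and> i < int (length w) then (if w ! nat i then 2 else 1) else 0), 0)"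

definition init_config :: "tm \<Rightarrow> word \<Rightarrow> config" where
  "init_config M x = (0, word_tape x # replicate (tapes M - 1) (word_tape []))"

text \<open>
  The input is read from tape \<open>0\<close> and the output is left on tape \<open>1\<close>, which at the end
  holds nothing else and has its head on the first symbol. This normalization of the output costs
  at most a polynomial overhead. Since \<open>step\<close> does not change halting configurations,
  the following says that \<open>M\<close> on input \<open>x\<close> halts with output \<open>y\<close> after at most \<open>t\<close> steps.
\<close>

definition outputs_within :: "tm \<Rightarrow> word \<Rightarrow> word \<Rightarrow> nat \<Rightarrow> bool" where
  "outputs_within M x y t \<longleftrightarrow>
     (case (step M ^^ t) (init_config M x) of (q, ts) \<Rightarrow>
        q = states M \<and> ts ! 1 = word_tape y)"

text \<open>
  \<open>f\<close> is computable on the domain \<open>D\<close> in time polynomial in the length of the encoded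
  argument, where \<open>e\<close> and \<open>e'\<close> encode the arguments and the values of \<open>f\<close>.
\<close>

definition polytime :: "('a \<Rightarrow> word) \<Rightarrow> ('b \<Rightarrow> word) \<Rightarrow> 'a set \<Rightarrow> ('a \<Rightarrow> 'b) \<Rightarrow> bool" where
  "polytime e e' D f \<longleftrightarrow>
     (\<exists>M (p :: nat poly). wf_tm M \<and>
        (\<forall>x\<in>D. outputs_within M (e x) (e' (f x)) (poly p (length (e x)))))"

section \<open>Problems\<close>

text \<open>
  \<open>Verdict\<close> is the kind of answer given by decision problems. The answers to function problems are
  \<open>Witness s\<close> for a solution \<open>s\<close>, and \<open>Nil_answer\<close> if there is no solution.
\<close>

datatype 's answer = Verdict bool | Nil_answer | Witness 's

record ('i, 's) problem =
  inputs :: "'i set"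
  input_size :: "'i \<Rightarrow> nat"
  encode_input :: "'i \<Rightarrow> word"
  encode_witness :: "'s \<Rightarrow> word"
  sol :: "'i \<Rightarrow> 's answer set"

definition decision_problem :: "('i, 's) problem \<Rightarrow> bool" where
  "decision_problem P \<longleftrightarrow> (\<forall>I\<in>inputs P. \<exists>b. sol P I = {Verdict b})"

definition function_problem :: "('i, 's) problem \<Rightarrow> bool" where
  "function_problem P \<longleftrightarrow>
     (\<forall>I\<in>inputs P. sol P I = {Nil_answer} \<or> (\<exists>S. S \<noteq> {} \<and> sol P I = Witness ` S))"

text \<open>
  The size of an input may be any measure polynomially equivalent to the length of its encoding
  (for instance that length itself), so that running times are polynomial in the one iff they are
  polynomial in the other.
\<close>

definition problem :: "('i, 's) problem \<Rightarrow> bool" where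
  "problem P \<longleftrightarrow>
     (decision_problem P \<or> function_problem P) \<and>
     inj_on (encode_input P) (inputs P) \<and>
     inj_on (encode_witness P) {s. \<exists>I\<in>inputs P. Witness s \<in> sol P I} \<and>
     (\<exists>p :: nat poly. \<forall>I\<in>inputs P.
        input_size P I \<le> poly p (length (encode_input P I)) \<and>
        length (encode_input P I) \<le> poly p (input_size P I))"

fun encode_answer :: "('i, 's) problem \<Rightarrow> 's answer \<Rightarrow> word" where
  "encode_answer P (Verdict b) = [False, b]"
| "encode_answer P Nil_answer = []"
| "encode_answer P (Witness s) = True # encode_witness P s"

definition in_FP :: "('i, 's) problem \<Rightarrow> bool" where
  "in_FP P \<longleftrightarrow> function_problem P \<and>
     (\<exists>f. polytime (encode_input P) (encode_answer P) (inputs P) f \<and>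
          (\<forall>I\<in>inputs P. f I \<in> sol P I))"

section \<open>The relaxed problem\<close>

text \<open>Self-delimiting: every bit of \<open>u\<close> is preceded by \<open>True\<close>, and \<open>False\<close> marks the end of \<open>u\<close>.\<close>

definition encode_pair :: "word \<Rightarrow> word \<Rightarrow> word" where
  "encode_pair u v = concat (map (\<lambda>b. [True, b]) u) @ False # v"

definition Rel :: "('i, 's) problem \<Rightarrow> ('i \<Rightarrow> 'i \<Rightarrow> real) \<Rightarrow> (nat \<Rightarrow> ennreal)
    \<Rightarrow> ('i, 'i \<times> 's answer) problem" where
  "Rel P \<rho> d =
     \<lparr> inputs = inputs P,
       input_size = input_size P,
       encode_input = encode_input P,
       encode_witness = (\<lambda>(J, a). encode_pair (encode_input P J) (encode_answer P a)),
       sol = (\<lambda>I. Witness `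
         {(J, a). J \<in> inputs P \<and> ennreal (\<rho> I J) \<le> d (input_size P I) \<and> a \<in> sol P J}) \<rparr>"

lemma encode_pair_inject: "encode_pair u v = encode_pair u' v' \<longleftrightarrow> u = u' \<and> v = v'"
proof (induction u arbitrary: u')
  case Nil
  then show ?case by (cases u') (auto simp: encode_pair_def)
next
  case (Cons b u)
  then show ?case by (cases u') (auto simp: encode_pair_def)
qed

lemma function_problem_Rel:
  assumes "problem P" and "Metric_space (inputs P) \<rho>"
  shows "function_problem (Rel P \<rho> d)"
proof -
  have "\<exists>J a. J \<in> inputs P \<and> ennreal (\<rho> I J) \<le> d (input_size P I) \<and> a \<in> sol P J"
    if I: "I \<in> inputs P" for I
  proof -
    have "\<rho> I I = 0"
      using assms(2) I by (simp add: Metric_space.mdist_zero)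
    moreover obtain a where "a \<in> sol P I"
      using assms(1) I unfolding problem_def decision_problem_def function_problem_def
      by (elim conjE disjE) (metis insertI1 image_is_empty ex_in_conv)+
    ultimately show ?thesis
      using I by (intro exI[of _ I] exI[of _ a]) simp
  qed
  then have ne: "{(J, a). J \<in> inputs P \<and> ennreal (\<rho> I J) \<le> d (input_size P I) \<and> a \<in> sol P J} \<noteq> {}"
    if "I \<in> inputs P" for I
    using that by blast
  show ?thesis
    unfolding function_problem_def Rel_def problem.simps
    by (intro ballI disjI2 exI conjI, erule ne, rule refl)
qed

lemma problem_Rel:
  assumes P: "problem P" and M: "Metric_space (inputs P) \<rho>"
  shows "problem (Rel P \<rho> d)"
proof -
  let ?W = "{s. \<exists>I\<in>inputs P. Witness s \<in> sol P I}"
  have injI: "inj_on (encode_input P) (inputs P)" and injW: "inj_on (encode_witness P) ?W"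
    and size: "\<exists>p :: nat poly. \<forall>I\<in>inputs P.
        input_size P I \<le> poly p (length (encode_input P I)) \<and>
        length (encode_input P I) \<le> poly p (input_size P I)"
    using P by (simp_all add: problem_def)
  have injA: "a = b" if e: "encode_answer P a = encode_answer P b"
    and ab: "a \<in> sol P I" "b \<in> sol P J" "I \<in> inputs P" "J \<in> inputs P" for a b I J
  proof (cases a)
    case (Witness s)
    then obtain s' where s': "b = Witness s'"
      using e by (cases b) auto
    have "s \<in> ?W" "s' \<in> ?W" using ab Witness s' by auto
    moreover have "encode_witness P s = encode_witness P s'" using e Witness s' by simp
    ultimately have "s = s'" using inj_onD[OF injW] by blast
    then show ?thesis using Witness s' by simp
  next
    case (Verdict c)
    then show ?thesis using e by (cases b) auto
  next
    case Nil_answer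
    then show ?thesis using e by (cases b) auto
  qed
  have "inj_on (encode_witness (Rel P \<rho> d))
          {s. \<exists>I\<in>inputs (Rel P \<rho> d). Witness s \<in> sol (Rel P \<rho> d) I}"
  proof (rule inj_onI)
    fix s s'
    assume s: "s \<in> {s. \<exists>I\<in>inputs (Rel P \<rho> d). Witness s \<in> sol (Rel P \<rho> d) I}"
      and s': "s' \<in> {s. \<exists>I\<in>inputs (Rel P \<rho> d). Witness s \<in> sol (Rel P \<rho> d) I}"
      and e: "encode_witness (Rel P \<rho> d) s = encode_witness (Rel P \<rho> d) s'"
    obtain J a where J: "s = (J, a)" "J \<in> inputs P" "a \<in> sol P J"
      using s by (auto simp: Rel_def)
    obtain J' a' where J': "s' = (J', a')" "J' \<in> inputs P" "a' \<in> sol P J'"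
      using s' by (auto simp: Rel_def)
    have "encode_input P J = encode_input P J'" "encode_answer P a = encode_answer P a'"
      using e J J' by (simp_all add: Rel_def encode_pair_inject)
    then show "s = s'"
      using J J' injA[of a a' J J'] inj_onD[OF injI, of J J'] by simp
  qed
  then show ?thesis
    using function_problem_Rel[OF P M, of d] injI size
    unfolding problem_def Rel_def problem.simps by (intro conjI disjI2)
qed

section \<open>Polynomial-time isomorphisms\<close>

definition polytime_isomorphism ::
  "('i, 's) problem \<Rightarrow> ('j, 't) problem \<Rightarrow> ('i \<Rightarrow> 'j) \<Rightarrow> ('t answer \<Rightarrow> 's answer) \<Rightarrow> bool" where
  "polytime_isomorphism P P' \<phi> \<psi> \<longleftrightarrow>
     bij_betw \<phi> (inputs P) (inputs P') \<and>
     polytime (encode_input P) (encode_input P') (inputs P) \<phi> \<and>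
     polytime (encode_input P') (encode_input P) (inputs P') (inv_into (inputs P) \<phi>) \<and>
     polytime (encode_answer P') (encode_answer P) (\<Union>J\<in>inputs P'. sol P' J) \<psi> \<and>
     (\<forall>I\<in>inputs P. \<forall>x\<in>sol P' (\<phi> I). \<psi> x \<in> sol P I) \<and>
     (decision_problem P \<and> decision_problem P' \<longrightarrow>
        \<psi> (Verdict True) = Verdict True \<and> \<psi> (Verdict False) = Verdict False)"

definition length_preserving ::
  "('i, 's) problem \<Rightarrow> ('j, 't) problem \<Rightarrow> ('i \<Rightarrow> 'j) \<Rightarrow> bool" where
  "length_preserving P P' \<phi> \<longleftrightarrow> (\<forall>I\<in>inputs P. input_size P' (\<phi> I) = input_size P I)"

end

theory Submission
  imports Defs
begin

text \<open>
  Given an input \<open>I\<close> of \<open>P\<close>, solve the relaxed problem for \<open>P'\<close> on \<open>\<phi> I\<close> and pull the answer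
  \<open>(J', a')\<close> back to \<open>(J, a)\<close>, where \<open>\<phi> J = J'\<close> and \<open>a = \<psi> a'\<close>. The isometry and the preservation
  of sizes turn the bound on \<open>dist' (\<phi> I) J'\<close> into the bound on \<open>dist I J\<close>. What needs work is that
  Turing machines can be composed and can process the two components of a pair: machines run on
  disjoint blocks of tapes that only share the tapes through which they communicate, so that
  nothing ever has to be erased. The output normalization (the output tape holds nothing else and
  its head is rewound) makes the output tape of one machine a legal input tape of the next.
\<close>

section \<open>Running, sequencing and embedding machines\<close>

text \<open>Unlike in \<open>outputs_within\<close>, the starting tapes are free and all final tapes
  are recorded, since a machine in a sequence starts on what its predecessor left. Halted
  configurations are fixed points, so \<open>t\<close> is only an upper bound.\<close>

definition halts_within :: "tm \<Rightarrow> tape list \<Rightarrow> tape list \<Rightarrow> nat \<Rightarrow> bool" where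
  "halts_within M ts ts' t \<longleftrightarrow> (step M ^^ t) (0, ts) = (states M, ts')"

lemma outputs_within_iff:
  "outputs_within M x y t \<longleftrightarrow>
     (\<exists>ts'. halts_within M (word_tape x # replicate (tapes M - 1) (word_tape [])) ts' t \<and>
       ts' ! 1 = word_tape y)"
  unfolding outputs_within_def halts_within_def init_config_def
  by (auto split: prod.splits)

lemma step_halted: "states M \<le> q \<Longrightarrow> step M (q, ts) = (q, ts)"
  by (simp add: step_def)

lemma steps_halted: "states M \<le> q \<Longrightarrow> (step M ^^ t) (q, ts) = (q, ts)"
  by (induction t) (simp_all add: step_halted)

lemma steps_mono:
  assumes "(step M ^^ t) cf = (states M, ts)" "t \<le> t'"
  shows "(step M ^^ t') cf = (states M, ts)"
proof -
  have "(step M ^^ ((t' - t) + t)) cf = (states M, ts)"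
    unfolding funpow_add using assms(1) by (simp add: steps_halted)
  then show ?thesis using assms(2) by simp
qed

lemma halts_within_mono: "halts_within M ts ts' t \<Longrightarrow> t \<le> t' \<Longrightarrow> halts_within M ts ts' t'"
  unfolding halts_within_def by (rule steps_mono)

lemma outputs_within_mono: "outputs_within M x y t \<Longrightarrow> t \<le> t' \<Longrightarrow> outputs_within M x y t'"
  unfolding outputs_within_iff using halts_within_mono by blast

lemma steps_trans:
  "(step M ^^ t) a = b \<Longrightarrow> (step M ^^ t') b = c \<Longrightarrow> (step M ^^ (t + t')) a = c"
  by (subst add.commute) (simp add: funpow_add)

lemma wf_tm_deltaD:
  assumes "wf_tm M" "q < states M" "length ss = tapes M \<and> set ss \<subseteq> {..<alphabet M}"
  shows "case delta M q ss of (q', acts) \<Rightarrow>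
    q' \<le> states M \<and> length acts = tapes M \<and> (\<forall>(s, m)\<in>set acts. s < alphabet M)"
proof -
  have "\<forall>q<states M. \<forall>ss. length ss = tapes M \<and> set ss \<subseteq> {..<alphabet M} \<longrightarrow>
      (case delta M q ss of (q', acts) \<Rightarrow>
         q' \<le> states M \<and> length acts = tapes M \<and> (\<forall>(s, m)\<in>set acts. s < alphabet M))"
    using assms(1) unfolding wf_tm_def by (elim conjE)
  from this[THEN spec, THEN mp, OF assms(2), THEN spec, THEN mp, OF assms(3)] show ?thesis .
qed

text \<open>The halting state of \<open>M\<close> serves as the start state of \<open>N\<close>.\<close>

definition seq_tm :: "tm \<Rightarrow> tm \<Rightarrow> tm" where
  "seq_tm M N =
     \<lparr> tapes = tapes M, alphabet = alphabet M, states = states M + states N,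
       delta = (\<lambda>q ss. if q < states M then delta M q ss
                        else apfst ((+) (states M)) (delta N (q - states M) ss)) \<rparr>"

lemma seq_tm_sel [simp]:
  "tapes (seq_tm M N) = tapes M" "alphabet (seq_tm M N) = alphabet M"
  "states (seq_tm M N) = states M + states N"
  by (simp_all add: seq_tm_def)

lemma wf_seq_tm:
  assumes "wf_tm M" "wf_tm N" "tapes M = tapes N" "alphabet M = alphabet N"
  shows "wf_tm (seq_tm M N)"
  unfolding wf_tm_def
proof (intro conjI allI impI)
  fix q ss
  assume q: "q < states (seq_tm M N)"
    and ss: "length ss = tapes (seq_tm M N) \<and> set ss \<subseteq> {..<alphabet (seq_tm M N)}"
  show "case delta (seq_tm M N) q ss of (q', acts) \<Rightarrow>
      q' \<le> states (seq_tm M N) \<and> length acts = tapes (seq_tm M N) \<and>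
      (\<forall>(s, m)\<in>set acts. s < alphabet (seq_tm M N))"
  proof (cases "q < states M")
    case True
    then have "case delta M q ss of (q', acts) \<Rightarrow>
           q' \<le> states M \<and> length acts = tapes M \<and> (\<forall>(s, m)\<in>set acts. s < alphabet M)"
      using wf_tm_deltaD[OF assms(1), of q ss] ss by simp
    then show ?thesis using True by (auto simp: seq_tm_def)
  next
    case False
    then have "q - states M < states N" using q by simp
    then have "case delta N (q - states M) ss of (q', acts) \<Rightarrow>
           q' \<le> states N \<and> length acts = tapes N \<and> (\<forall>(s, m)\<in>set acts. s < alphabet N)"
      using wf_tm_deltaD[OF assms(2), of "q - states M" ss] assms(3,4) ss by simp
    then show ?thesis using False assms(3,4) by (auto simp: seq_tm_def)
  qed
qed (use assms(1) in \<open>auto simp: wf_tm_def\<close>)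

text \<open>Only some \<open>t' \<le> t\<close> can be promised: \<open>M\<close> may halt before
  step \<open>t\<close> and then idles, whereas the sequenced machine moves on into
  \<open>N\<close>.\<close>

lemma seq_tm_first:
  assumes "(step M ^^ t) (q, ts) = (states M, ts')"
  shows "\<exists>t'\<le>t. (step (seq_tm M N) ^^ t') (q, ts) = (states M, ts')"
  using assms
proof (induction t arbitrary: q ts)
  case 0
  then show ?case by simp
next
  case (Suc t)
  show ?case
  proof (cases "q < states M")
    case True
    then have eq: "step (seq_tm M N) (q, ts) = step M (q, ts)"
      by (simp add: step_def seq_tm_def)
    obtain q1 ts1 where 1: "step M (q, ts) = (q1, ts1)" by fastforce
    then have "(step M ^^ t) (q1, ts1) = (states M, ts')"
      using Suc.prems by (simp add: funpow_swap1)
    then obtain t' where "t' \<le> t" "(step (seq_tm M N) ^^ t') (q1, ts1) = (states M, ts')"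
      using Suc.IH by blast
    then show ?thesis
      using eq 1 by (intro exI[of _ "Suc t'"]) (simp add: funpow_swap1)
  next
    case False
    then show ?thesis
      using Suc.prems steps_halted[of M q "Suc t" ts] by (intro exI[of _ 0]) auto
  qed
qed

text \<open>Adding \<open>states M\<close> to the state number commutes with \<open>step\<close>,
  also on halted configurations.\<close>

lemma seq_tm_second:
  "(step (seq_tm M N) ^^ t) (states M + q, ts) = apfst ((+) (states M)) ((step N ^^ t) (q, ts))"
proof (induction t)
  case (Suc t)
  have "step (seq_tm M N) (apfst ((+) (states M)) cf) = apfst ((+) (states M)) (step N cf)" for cf
    by (cases cf) (auto simp: step_def seq_tm_def split: prod.splits)
  then show ?case using Suc by simp
qed simp

lemma halts_within_seq:
  assumes "halts_within M ts ts' t" "halts_within N ts' ts'' t'"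
  shows "halts_within (seq_tm M N) ts ts'' (t + t')"
proof -
  obtain t1 where t1: "t1 \<le> t" "(step (seq_tm M N) ^^ t1) (0, ts) = (states M, ts')"
    using seq_tm_first assms(1) unfolding halts_within_def by blast
  have "(step (seq_tm M N) ^^ t') (states M, ts') = (states (seq_tm M N), ts'')"
    using seq_tm_second[where q = 0] assms(2) by (simp add: halts_within_def)
  with t1(2) have "halts_within (seq_tm M N) ts ts'' (t1 + t')"
    unfolding halts_within_def by (rule steps_trans)
  then show ?thesis using t1(1) by (elim halts_within_mono) simp
qed

section \<open>The tape alphabet as an invariant, and the length of outputs\<close>

text \<open>\<open>wf_tm\<close> restricts \<open>delta\<close> only on symbols of the alphabet, so
  using it along a run requires every cell, not just the scanned ones, to stay in range.\<close>

definition valid_tapes :: "tm \<Rightarrow> tape list \<Rightarrow> bool" where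
  "valid_tapes M ts \<longleftrightarrow> length ts = tapes M \<and> (\<forall>t\<in>set ts. \<forall>i. fst t i < alphabet M)"

text \<open>The length matters because \<open>map2\<close> truncates: a shorter list of actions
  would make \<open>step\<close> drop tapes.\<close>

lemma wf_tm_delta:
  assumes "wf_tm M" "valid_tapes M ts" "q < states M" "delta M q (map scanned ts) = (q', acts)"
  shows "length acts = tapes M" "\<And>s m. (s, m) \<in> set acts \<Longrightarrow> s < alphabet M"
proof -
  have "length (map scanned ts) = tapes M \<and> set (map scanned ts) \<subseteq> {..<alphabet M}"
    using assms(2) by (auto simp: valid_tapes_def scanned_def)
  then have "case delta M q (map scanned ts) of (q', acts) \<Rightarrow>
           q' \<le> states M \<and> length acts = tapes M \<and> (\<forall>(s, m)\<in>set acts. s < alphabet M)"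
    by (rule wf_tm_deltaD[OF assms(1,3)])
  then show "length acts = tapes M" "\<And>s m. (s, m) \<in> set acts \<Longrightarrow> s < alphabet M"
    using assms(4) by auto
qed

lemma act_eq: "act t a = ((fst t)(snd t := fst a), shift (snd a) (snd t))"
  by (cases t; cases a) simp

lemma valid_step:
  assumes "wf_tm M" "valid_tapes M (snd cf)"
  shows "valid_tapes M (snd (step M cf))"
proof -
  obtain q ts where cf: "cf = (q, ts)" by fastforce
  show ?thesis
  proof (cases "q < states M")
    case True
    obtain q' acts where d: "delta M q (map scanned ts) = (q', acts)" by fastforce
    note w = wf_tm_delta[OF assms(1) _ True d]
    have v: "valid_tapes M ts" using assms(2) cf by simp
    have "fst t i < alphabet M" if "t \<in> set (map2 act ts acts)" for t i
    proof -
      obtain u a where "t = act u a" "u \<in> set ts" "a \<in> set acts"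
        using \<open>t \<in> _\<close> by (force simp del: act.simps dest: set_zip_leftD set_zip_rightD)
      then show ?thesis using w(2)[of "fst a" "snd a"] v
        by (auto simp: act_eq valid_tapes_def)
    qed
    then show ?thesis using w(1) v True d cf by (auto simp: valid_tapes_def step_def)
  next
    case False
    then show ?thesis using assms(2) cf by (simp add: step_halted)
  qed
qed

lemma valid_steps:
  "wf_tm M \<Longrightarrow> valid_tapes M (snd cf) \<Longrightarrow> valid_tapes M (snd ((step M ^^ t) cf))"
  by (induction t) (simp_all add: valid_step)

lemma valid_init:
  "wf_tm M \<Longrightarrow> valid_tapes M (word_tape x # replicate (tapes M - 1) (word_tape []))"
  by (auto simp: valid_tapes_def wf_tm_def word_tape_def)

text \<open>Each step writes at most one new cell of the output tape.\<close>

lemma output_length: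
  assumes "wf_tm M" "outputs_within M x y t"
  shows "length y \<le> t"
proof -
  \<comment> \<open>The nonblank cells of the output tape: none at the start, at most one more per
    step, and exactly \<open>length y\<close> at the end because both bits have nonzero
    symbols.\<close>
  define nb where "nb cf = {i. fst (snd cf ! 1) i \<noteq> (0 :: nat)}" for cf :: config
  have ge2: "tapes M \<ge> 2" using assms(1) by (simp add: wf_tm_def)
  have "finite (nb ((step M ^^ s) (init_config M x))) \<and> card (nb ((step M ^^ s) (init_config M x))) \<le> s"
    for s
  proof (induction s)
    case 0
    have "replicate (tapes M - 1) (word_tape []) ! 0 = word_tape []"
      using ge2 by (intro nth_replicate) simp
    then show ?case by (simp add: nb_def init_config_def word_tape_def)
  next
    case (Suc s)
    obtain q ts where cf: "(step M ^^ s) (init_config M x) = (q, ts)" by fastforce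
    have v: "valid_tapes M ts"
      using valid_steps[OF assms(1), of "init_config M x" s] valid_init[OF assms(1)] cf
      by (simp add: init_config_def)
    show ?case
    proof (cases "q < states M")
      case True
      obtain q' acts where d: "delta M q (map scanned ts) = (q', acts)" by fastforce
      have "length acts = tapes M" "length ts = tapes M"
        using wf_tm_delta(1)[OF assms(1) v True d] v by (auto simp: valid_tapes_def)
      then have "nb (step M (q, ts)) \<subseteq> insert (snd (ts ! 1)) (nb (q, ts))"
        using True d ge2 by (auto simp: nb_def step_def act_eq split: if_splits)
      then show ?thesis using Suc cf
        by (auto intro: finite_subset dest: card_mono[rotated]
            simp: card_insert_if split: if_splits)
    next
      case False
      then show ?thesis using Suc cf by (simp add: step_halted)
    qed
  qed
  moreover have "nb ((step M ^^ t) (init_config M x)) = {0..<int (length y)}"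
    using assms(2) unfolding outputs_within_def nb_def
    by (auto simp: word_tape_def split: prod.splits if_splits)
  ultimately show ?thesis by (metis card_atLeastLessThan_int diff_zero nat_int)
qed

section \<open>Embedding a machine into more tapes\<close>

text \<open>
  Runs \<open>M\<close> on the tapes listed in \<open>is\<close>, and loops on symbols foreign to \<open>M\<close>, for which \<open>wf_tm\<close> does
  not constrain \<open>delta M\<close>.
\<close>

definition lift_tm :: "nat \<Rightarrow> nat \<Rightarrow> nat list \<Rightarrow> tm \<Rightarrow> tm" where
  "lift_tm A k is M =
     \<lparr> tapes = k, alphabet = A, states = states M,
       delta = (\<lambda>q ss. let rs = map ((!) ss) is in
         if set rs \<subseteq> {..<alphabet M}
         then (case delta M q rs of (q', acts) \<Rightarrow>
           (q', map (\<lambda>j. case map_of (zip is acts) j of Some a \<Rightarrow> a | None \<Rightarrow> (ss ! j, Stay)) [0..<k]))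
         else (q, map (\<lambda>s. (s, Stay)) ss)) \<rparr>"

lemma lift_tm_sel [simp]:
  "tapes (lift_tm A k is M) = k" "alphabet (lift_tm A k is M) = A"
  "states (lift_tm A k is M) = states M"
  by (simp_all add: lift_tm_def)

lemma wf_lift_tm:
  assumes "wf_tm M" "length is = tapes M" "distinct is" "set is \<subseteq> {..<k}" "alphabet M \<le> A"
  shows "wf_tm (lift_tm A k is M)"
  unfolding wf_tm_def
proof (intro conjI allI impI)
  \<comment> \<open>Distinct indices below \<open>k\<close> force \<open>k \<ge> tapes M\<close>,
    and \<open>tapes M \<ge> 2\<close>.\<close>
  have "card (set is) \<le> card {..<k}" by (intro card_mono assms(4)) simp
  then show "2 \<le> tapes (lift_tm A k is M)"
    using assms(1,2,3) by (simp add: distinct_card wf_tm_def)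
  show "3 \<le> alphabet (lift_tm A k is M)" "1 \<le> states (lift_tm A k is M)"
    using assms(1,5) by (auto simp: wf_tm_def)
next
  fix q ss
  assume q: "q < states (lift_tm A k is M)"
    and ss: "length ss = tapes (lift_tm A k is M) \<and> set ss \<subseteq> {..<alphabet (lift_tm A k is M)}"
  let ?rs = "map ((!) ss) is"
  show "case delta (lift_tm A k is M) q ss of (q', acts) \<Rightarrow>
      q' \<le> states (lift_tm A k is M) \<and> length acts = tapes (lift_tm A k is M) \<and>
      (\<forall>(s, m)\<in>set acts. s < alphabet (lift_tm A k is M))"
  proof (cases "set ?rs \<subseteq> {..<alphabet M}")
    case True
    obtain q' acts where d: "delta M q ?rs = (q', acts)" by fastforce
    have "length ?rs = tapes M" using assms(2) by simp
    then have w: "q' \<le> states M" "length acts = tapes M" "\<forall>(s, m)\<in>set acts. s < alphabet M"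
      using wf_tm_deltaD[OF assms(1), of q ?rs] q True d by auto
    have "fst (case map_of (zip is acts) j of Some a \<Rightarrow> a | None \<Rightarrow> (ss ! j, Stay)) < A"
      if "j < k" for j
    proof (cases "map_of (zip is acts) j")
      case None
      have "ss ! j \<in> set ss" using ss that by simp
      then show ?thesis using None ss by auto
    next
      case (Some a)
      then have "a \<in> set acts" by (meson map_of_SomeD set_zip_rightD)
      then have "fst a < alphabet M" using w(3) by (cases a) auto
      then show ?thesis using Some assms(5) by simp
    qed
    then show ?thesis using True d w(1) by (auto simp: lift_tm_def Let_def)
       (metis fst_conv)+
  next
    case False
    then show ?thesis using q ss by (auto simp: lift_tm_def Let_def)
  qed
qed

text \<open>Distinctness makes \<open>map_of\<close> find the action meant for each listed tape;
  every other tape has its scanned symbol written back and keeps its head position.\<close>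

lemma lift_step:
  assumes M: "wf_tm M" and "is": "length is = tapes M" "distinct is" "set is \<subseteq> {..<k}"
    and ts: "length ts = k" "valid_tapes M (map ((!) ts) is)"
  shows "\<exists>ts'. step (lift_tm A k is M) (q, ts) = (fst (step M (q, map ((!) ts) is)), ts') \<and>
    map ((!) ts') is = snd (step M (q, map ((!) ts) is)) \<and>
    length ts' = k \<and> (\<forall>j<k. j \<notin> set is \<longrightarrow> ts' ! j = ts ! j)"
proof (cases "q < states M")
  case True
  let ?rs = "map ((!) (map scanned ts)) is"
  have rs: "?rs = map scanned (map ((!) ts) is)"
    using "is"(3) ts(1) by auto
  have sub: "set ?rs \<subseteq> {..<alphabet M}"
    unfolding rs using ts(2) by (auto simp: valid_tapes_def scanned_def)
  obtain q' acts where d: "delta M q ?rs = (q', acts)" by fastforce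
  have len: "length acts = tapes M"
    using wf_tm_delta(1)[OF M ts(2) True] d rs by simp
  define as where
    "as = map (\<lambda>j. case map_of (zip is acts) j of Some a \<Rightarrow> a | None \<Rightarrow> (map scanned ts ! j, Stay)) [0..<k]"
  have las: "length as = k" by (simp add: as_def)
  have s1: "step (lift_tm A k is M) (q, ts) = (q', map2 act ts as)"
    using True sub d unfolding step_def as_def by (simp add: lift_tm_def Let_def)
  have s2: "step M (q, map ((!) ts) is) = (q', map2 act (map ((!) ts) is) acts)"
    using True d rs by (simp add: step_def)
  have "map ((!) (map2 act ts as)) is = map2 act (map ((!) ts) is) acts"
  proof (rule nth_equalityI)
    fix n assume "n < length (map ((!) (map2 act ts as)) is)"
    then have n: "n < length is" by simp
    then have "is ! n < k" using "is"(3) nth_mem by blast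
    moreover have "map_of (zip is acts) (is ! n) = Some (acts ! n)"
      using n len "is" by (intro map_of_zip_nth) auto
    ultimately show "map ((!) (map2 act ts as)) is ! n = map2 act (map ((!) ts) is) acts ! n"
      using n len "is"(1) ts(1) las by (simp add: as_def)
  qed (use len "is"(1) in simp)
  moreover have "map2 act ts as ! j = ts ! j" if "j < k" "j \<notin> set is" for j
  proof -
    have "map_of (zip is acts) j = None" using that len "is"(1) by (simp add: map_of_zip_is_None)
    then show ?thesis using that ts(1) las by (simp add: as_def act_eq scanned_def)
  qed
  ultimately show ?thesis using s1 s2 las ts(1) by auto
next
  case False
  then show ?thesis using ts(1) by (intro exI[of _ ts]) (simp add: step_halted)
qed

lemma lift_steps:
  assumes M: "wf_tm M" and "is": "length is = tapes M" "distinct is" "set is \<subseteq> {..<k}"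
    and ts: "length ts = k" "valid_tapes M (map ((!) ts) is)"
  shows "\<exists>ts'. (step (lift_tm A k is M) ^^ t) (q, ts) =
      (fst ((step M ^^ t) (q, map ((!) ts) is)), ts') \<and>
    map ((!) ts') is = snd ((step M ^^ t) (q, map ((!) ts) is)) \<and>
    length ts' = k \<and> (\<forall>j<k. j \<notin> set is \<longrightarrow> ts' ! j = ts ! j)"
proof (induction t)
  case 0
  then show ?case using ts(1) by simp
next
  case (Suc t)
  obtain q1 rs1 where r: "(step M ^^ t) (q, map ((!) ts) is) = (q1, rs1)" by fastforce
  then obtain ts1 where t1: "(step (lift_tm A k is M) ^^ t) (q, ts) = (q1, ts1)"
    "map ((!) ts1) is = rs1" "length ts1 = k" "\<forall>j<k. j \<notin> set is \<longrightarrow> ts1 ! j = ts ! j"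
    using Suc by auto
  \<comment> \<open>The run of \<open>M\<close> itself preserves validity of the selected tapes, so
    the one-step simulation applies again.\<close>
  have "valid_tapes M (map ((!) ts1) is)"
    using valid_steps[OF M, of "(q, map ((!) ts) is)" t] ts(2) r t1(2) by simp
  from lift_step[OF M "is" t1(3) this, of A q1]
  show ?case using t1 r by auto
qed

lemma halts_within_lift:
  assumes M: "wf_tm M" and "is": "length is = tapes M" "distinct is" "set is \<subseteq> {..<k}"
    and ts: "length ts = k" "valid_tapes M (map ((!) ts) is)"
    and run: "halts_within M (map ((!) ts) is) rs t"
  obtains ts' where "halts_within (lift_tm A k is M) ts ts' t" "map ((!) ts') is = rs"
    "length ts' = k" "\<And>j. j < k \<Longrightarrow> j \<notin> set is \<Longrightarrow> ts' ! j = ts ! j"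
  using lift_steps[OF M "is" ts, where A = A and t = t and q = 0] run unfolding halts_within_def by auto

text \<open>The form used for chaining: \<open>a\<close> is the tape read, \<open>b\<close> the tape
  written, and \<open>js\<close> are blank scratch tapes. Tapes outside the block survive, so
  results and blanks remain available to later machines.\<close>

lemma outputs_within_lift:
  assumes M: "wf_tm M" and len: "length is = tapes M" and "is": "is = a # b # js"
    and d: "distinct is" "set is \<subseteq> {..<k}"
    and ts: "length ts = k" "ts ! a = word_tape x" "ts ! b = word_tape []"
      "\<And>j. j \<in> set js \<Longrightarrow> ts ! j = word_tape []"
    and run: "outputs_within M x y t"
  obtains ts' where "halts_within (lift_tm A k is M) ts ts' t" "ts' ! b = word_tape y"
    "length ts' = k" "\<And>j. j < k \<Longrightarrow> j \<notin> set is \<Longrightarrow> ts' ! j = ts ! j"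
proof -
  have *: "map ((!) ts) is = word_tape x # replicate (tapes M - 1) (word_tape [])"
    using len ts(2-4) unfolding "is"
    by (auto simp: list_eq_iff_nth_eq nth_Cons' nth_replicate)
  obtain rs where rs: "halts_within M (map ((!) ts) is) rs t" "rs ! 1 = word_tape y"
    using run unfolding outputs_within_iff * by blast
  have "valid_tapes M (map ((!) ts) is)" unfolding * by (rule valid_init[OF M])
  from halts_within_lift[OF M len d ts(1) this rs(1)] obtain ts' where
    t: "halts_within (lift_tm A k is M) ts ts' t" "map ((!) ts') is = rs"
    "length ts' = k" "\<And>j. j < k \<Longrightarrow> j \<notin> set is \<Longrightarrow> ts' ! j = ts ! j"
    by metis
  have "ts' ! b = rs ! 1" using t(2) "is" by auto
  then show ?thesis using that t rs(2) by metis
qed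

section \<open>Composition of polynomial-time functions\<close>

text \<open>Natural coefficients are nonnegative.\<close>

lemma poly_nat_mono: "a \<le> b \<Longrightarrow> poly (p :: nat poly) a \<le> poly p b"
  by (induction p) (simp_all add: mult_le_mono)

text \<open>\<open>N\<close> starts on the very tape that holds the output of \<open>M\<close>. The
  time bounds compose because the intermediate word is no longer than the running time of
  \<open>M\<close>.\<close>

lemma polytime_comp:
  assumes "polytime e e' D f" "polytime e' e'' D' g" "f ` D \<subseteq> D'"
  shows "polytime e e'' D (g \<circ> f)"
proof -
  obtain M p where M: "wf_tm M"
    and runM: "\<And>x. x \<in> D \<Longrightarrow> outputs_within M (e x) (e' (f x)) (poly p (length (e x)))"
    using assms(1) unfolding polytime_def by blast
  obtain N r where N: "wf_tm N"
    and runN: "\<And>x. x \<in> D' \<Longrightarrow> outputs_within N (e' x) (e'' (g x)) (poly r (length (e' x)))"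
    using assms(2) unfolding polytime_def by blast
  let ?A = "max (alphabet M) (alphabet N)"
  \<comment> \<open>The machines share only tape 2, which holds the intermediate word; tape 0 is the
    input of \<open>M\<close> and tape 1 the output of \<open>N\<close>.\<close>
  let ?k = "tapes M + tapes N - 1"
  let ?js = "[3..<tapes M + 1]" and ?js' = "[tapes M + 1..<?k]"
  let ?is = "0 # 2 # ?js" and ?is' = "2 # 1 # ?js'"
  let ?M = "lift_tm ?A ?k ?is M" and ?N = "lift_tm ?A ?k ?is' N"
  have ge: "tapes M \<ge> 2" "tapes N \<ge> 2" using M N by (auto simp: wf_tm_def)
  have I: "length ?is = tapes M" "distinct ?is" "set ?is \<subseteq> {..<?k}" using ge by auto
  have I': "length ?is' = tapes N" "distinct ?is'" "set ?is' \<subseteq> {..<?k}" using ge by auto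
  have wf: "wf_tm (seq_tm ?M ?N)"
    using wf_lift_tm[OF M I] wf_lift_tm[OF N I'] by (intro wf_seq_tm) auto
  have "outputs_within (seq_tm ?M ?N) (e x) (e'' (g (f x)))
      (poly (p + pcompose r p) (length (e x)))" if x: "x \<in> D" for x
  proof -
    let ?ts = "word_tape (e x) # replicate (?k - 1) (word_tape [])"
    let ?t = "poly p (length (e x))" and ?u = "poly r (length (e' (f x)))"
    have blank: "?ts ! j = word_tape []" if "j \<ge> 1" "j < ?k" for j
      using that by (simp add: nth_Cons')
    obtain ts1 where 1: "halts_within ?M ?ts ts1 ?t" "ts1 ! 2 = word_tape (e' (f x))"
      "length ts1 = ?k" "\<And>j. j < ?k \<Longrightarrow> j \<notin> set ?is \<Longrightarrow> ts1 ! j = ?ts ! j"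
    proof (rule outputs_within_lift[OF M I(1) refl I(2,3) _ _ _ _ runM[OF x], where ts = ?ts and A = ?A])
      show "length ?ts = ?k" using ge by simp
      show "?ts ! 0 = word_tape (e x)" by simp
      show "?ts ! 2 = word_tape []" using ge by (intro blank) auto
      show "?ts ! j = word_tape []" if "j \<in> set ?js" for j
        using that ge by (intro blank) auto
    qed blast
    have blank1: "ts1 ! j = word_tape []" if "j \<ge> 1" "j < ?k" "j \<notin> set ?is" for j
      using that 1(4) blank by simp
    obtain ts2 where 2: "halts_within ?N ts1 ts2 ?u" "ts2 ! 1 = word_tape (e'' (g (f x)))"
    proof (rule outputs_within_lift[OF N I'(1) refl I'(2,3) 1(3,2) _ _ runN, where A = ?A])
      show "ts1 ! 1 = word_tape []" using ge by (intro blank1) auto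
      show "ts1 ! j = word_tape []" if "j \<in> set ?js'" for j
        using that ge by (intro blank1) auto
      show "f x \<in> D'" using assms(3) x by auto
    qed blast
    have "outputs_within (seq_tm ?M ?N) (e x) (e'' (g (f x))) (?t + ?u)"
      unfolding outputs_within_iff using halts_within_seq[OF 1(1) 2(1)] 2(2) by auto
    moreover have "?u \<le> poly r ?t"
      by (intro poly_nat_mono output_length[OF M runM[OF x]])
    ultimately show ?thesis
      by (elim outputs_within_mono) (simp add: poly_pcompose)
  qed
  then show ?thesis using wf unfolding polytime_def comp_def by blast
qed

section \<open>Splitting and joining encoded pairs\<close>

lemma encode_pair_Nil [simp]: "encode_pair [] v = False # v"
  and encode_pair_Cons [simp]: "encode_pair (b # u) v = True # b # encode_pair u v"
  by (simp_all add: encode_pair_def)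

text \<open>The code of \<open>u\<close> with its end marker is a prefix independent of
  \<open>v\<close>, so a processed part can be written as \<open>encode_pair u []\<close>.\<close>

lemma encode_pair_append: "encode_pair u v = encode_pair u [] @ v"
  by (simp add: encode_pair_def)

lemma length_encode_pair: "length (encode_pair u v) = 2 * length u + 1 + length v"
  by (induction u) auto

definition sym :: "bool \<Rightarrow> nat" where
  "sym b = (if b then 2 else 1)"

text \<open>The tape that holds \<open>u @ v\<close>, with the head on the first symbol of \<open>v\<close>.\<close>

definition zipper :: "word \<Rightarrow> word \<Rightarrow> tape" where
  "zipper u v = (fst (word_tape (u @ v)), int (length u))"

text \<open>Needed beside \<open>zipper\<close> because moving left from the first cell puts the
  head on cell -1, which no \<open>zipper\<close> describes.\<close>

definition left :: "tape \<Rightarrow> tape" where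
  "left t = (fst t, snd t - 1)"

lemma sym_simps [simp]: "sym b \<noteq> 0" "0 \<noteq> sym b" "sym True = 2" "sym False = 1"
  by (simp_all add: sym_def)

lemma word_tape_zipper: "word_tape w = zipper [] w"
  by (simp add: zipper_def word_tape_def)

lemma scanned_zipper [simp]: "scanned (zipper u []) = 0" "scanned (zipper u (b # v)) = sym b"
  by (simp_all add: zipper_def word_tape_def scanned_def sym_def)

lemma scanned_left_zipper [simp]:
  "scanned (left (zipper [] v)) = 0" "scanned (left (zipper (u @ [b]) v)) = sym b"
  by (simp_all add: zipper_def left_def word_tape_def scanned_def sym_def nth_append)

lemma act_stay [simp]: "act t (scanned t, Stay) = t"
  and act_left [simp]: "act t (scanned t, MoveLeft) = left t"
  by (simp_all add: act_eq scanned_def left_def)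

lemma act_read [simp]: "act (zipper u (b # v)) (sym b, MoveRight) = zipper (u @ [b]) v"
  by (auto simp: act_eq zipper_def word_tape_def sym_def)

lemma act_write [simp]: "act (zipper u []) (sym b, MoveRight) = zipper (u @ [b]) []"
  by (auto simp: act_eq zipper_def word_tape_def sym_def nth_append fun_eq_iff)

text \<open>The end of a rewind: the head leaves the blank at cell -1 and returns to cell 0.\<close>

lemma act_bounce [simp]: "act (left (zipper [] v)) (0, MoveRight) = zipper [] v"
  by (auto simp: act_eq zipper_def word_tape_def left_def fun_eq_iff)

lemma left_zipper: "left (zipper (u @ [b]) v) = zipper u (b # v)"
  by (simp add: zipper_def left_def)

section \<open>The splitting and joining machines\<close>

text \<open>
  State 0 skips the leading \<open>True\<close>, states 1 and 2 copy the first word to tape 1, state 3 copies the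
  second word to tape 2, and states 4 and 5 rewind these two tapes.
\<close>

definition split_delta :: "nat \<Rightarrow> nat \<Rightarrow> nat \<Rightarrow> nat \<Rightarrow> nat \<times> (nat \<times> move) list" where
  "split_delta q a b c =
    (if q = 0 then (1, [(a, MoveRight), (b, Stay), (c, Stay)])
     else if q = 1 then (if a = 2 then 2 else 3, [(a, MoveRight), (b, Stay), (c, Stay)])
     else if q = 2 then (1, [(a, MoveRight), (a, MoveRight), (c, Stay)])
     else if q = 3 then
       if a = 0 then (4, [(a, Stay), (b, MoveLeft), (c, MoveLeft)])
       else (3, [(a, MoveRight), (b, Stay), (a, MoveRight)])
     else if q = 4 then
       if b = 0 then (5, [(a, Stay), (b, MoveRight), (c, Stay)])
       else (4, [(a, Stay), (b, MoveLeft), (c, Stay)])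
     else
       if c = 0 then (6, [(a, Stay), (b, Stay), (c, MoveRight)])
       else (5, [(a, Stay), (b, Stay), (c, MoveLeft)]))"

definition split_tm :: tm where
  "split_tm = \<lparr> tapes = 3, alphabet = 3, states = 6,
     delta = (\<lambda>q ss. split_delta q (ss ! 0) (ss ! 1) (ss ! 2)) \<rparr>"

text \<open>State 0 writes the leading \<open>True\<close>; state 1 writes the marker
  \<open>True\<close> before a bit or the end marker \<open>False\<close>, and state 2 copies the
  bit. State 3 appends the word of tape 1, and state 4 rewinds tape 2.\<close>

definition join_delta :: "nat \<Rightarrow> nat \<Rightarrow> nat \<Rightarrow> nat \<Rightarrow> nat \<times> (nat \<times> move) list" where
  "join_delta q a b c =
    (if q = 0 then (1, [(a, Stay), (b, Stay), (2, MoveRight)])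
     else if q = 1 then
       if a = 0 then (3, [(a, Stay), (b, Stay), (1, MoveRight)])
       else (2, [(a, Stay), (b, Stay), (2, MoveRight)])
     else if q = 2 then (1, [(a, MoveRight), (b, Stay), (a, MoveRight)])
     else if q = 3 then
       if b = 0 then (4, [(a, Stay), (b, Stay), (c, MoveLeft)])
       else (3, [(a, Stay), (b, MoveRight), (b, MoveRight)])
     else
       if c = 0 then (5, [(a, Stay), (b, Stay), (c, MoveRight)])
       else (4, [(a, Stay), (b, Stay), (c, MoveLeft)]))"

definition join_tm :: tm where
  "join_tm = \<lparr> tapes = 3, alphabet = 3, states = 5,
     delta = (\<lambda>q ss. join_delta q (ss ! 0) (ss ! 1) (ss ! 2)) \<rparr>"

lemma wf_split_tm: "wf_tm split_tm"
  and wf_join_tm: "wf_tm join_tm"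
  unfolding wf_tm_def
  by (auto simp: split_tm_def join_tm_def split_delta_def join_delta_def numeral_3_eq_3 length_Suc_conv)

lemma states_glue [simp]: "states split_tm = 6" "states join_tm = 5"
  by (simp_all add: split_tm_def join_tm_def)

lemma tapes_glue [simp]: "tapes split_tm = 3" "tapes join_tm = 3"
  by (simp_all add: split_tm_def join_tm_def)

lemma alphabet_glue [simp]: "alphabet split_tm = 3" "alphabet join_tm = 3"
  by (simp_all add: split_tm_def join_tm_def)


text \<open>The simplifier rewrites \<open>sym\<close> of a constant bit to 2 or
  \<open>Suc 0\<close>, where \<open>act_read\<close> no longer matches.\<close>

lemma act_read_bit [simp]:
  "act (zipper u (True # v)) (2, MoveRight) = zipper (u @ [True]) v"
  "act (zipper u (False # v)) (Suc 0, MoveRight) = zipper (u @ [False]) v"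
  using act_read[of u True v] act_read[of u False v] by simp_all

lemma act_write_bit [simp]:
  "act (zipper u []) (2, MoveRight) = zipper (u @ [True]) []"
  "act (zipper u []) (Suc 0, MoveRight) = zipper (u @ [False]) []"
  using act_write[of u True] act_write[of u False] by simp_all

lemma act_blank [simp]:
  "act (zipper u []) (0, Stay) = zipper u []"
  "act (zipper u []) (0, MoveLeft) = left (zipper u [])"
  using act_stay[of "zipper u []"] act_left[of "zipper u []"] by (simp_all del: act_stay act_left)

lemma steps_Suc: "(step M ^^ Suc t) cf = (step M ^^ t) (step M cf)"
  by (simp add: funpow_swap1)

lemma step_split:
  "step split_tm (q, [a, b, c]) = (if q < 6 then case split_delta q (scanned a) (scanned b) (scanned c) of
     (q', acts) \<Rightarrow> (q', map2 act [a, b, c] acts) else (q, [a, b, c]))"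
  by (simp add: step_def split_tm_def)

lemma step_join:
  "step join_tm (q, [a, b, c]) = (if q < 5 then case join_delta q (scanned a) (scanned b) (scanned c) of
     (q', acts) \<Rightarrow> (q', map2 act [a, b, c] acts) else (q, [a, b, c]))"
  by (simp add: step_def join_tm_def)

lemmas split_simps = step_split split_delta_def
lemmas join_simps = step_join join_delta_def

section \<open>Correctness of the splitting machine\<close>

text \<open>Each bit costs two steps, for its marker and for itself; the extra step reads the end
  marker. The prefixes \<open>p\<close> and \<open>r\<close> behind the heads make the induction go
  through.\<close>

lemma split_first:
  "(step split_tm ^^ (2 * length u + 1)) (1, [zipper p (encode_pair u v), zipper r [], c]) =
     (3, [zipper (p @ encode_pair u []) v, zipper (r @ u) [], c])"
proof (induction u arbitrary: p r)
  case Nil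
  show ?case by (simp add: split_simps)
next
  case (Cons b u)
  have 1: "step split_tm (1, [zipper p (True # b # encode_pair u v), zipper r [], c]) =
      (2, [zipper (p @ [True]) (b # encode_pair u v), zipper r [], c])"
    by (simp add: split_simps)
  have 2: "step split_tm (2, [zipper (p @ [True]) (b # encode_pair u v), zipper r [], c]) =
      (1, [zipper (p @ [True, b]) (encode_pair u v), zipper (r @ [b]) [], c])"
    by (simp add: split_simps)
  have len: "2 * length (b # u) + 1 = Suc (Suc (2 * length u + 1))" by simp
  show ?case
    unfolding len steps_Suc encode_pair_Cons 1 2 Cons.IH by simp
qed

text \<open>The extra step reads the blank after \<open>v\<close> and moves both output heads one
  cell left, where rewinding begins.\<close>

lemma split_second:
  "(step split_tm ^^ (length v + 1)) (3, [zipper p v, b, zipper r []]) =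
     (4, [zipper (p @ v) [], left b, left (zipper (r @ v) [])])"
proof (induction v arbitrary: p r)
  case Nil
  show ?case by (simp add: split_simps)
next
  case (Cons x v)
  have 1: "step split_tm (3, [zipper p (x # v), b, zipper r []]) =
      (3, [zipper (p @ [x]) v, b, zipper (r @ [x]) []])"
    by (simp add: split_simps)
  have len: "length (x # v) + 1 = Suc (length v + 1)" by simp
  show ?case
    unfolding len steps_Suc 1 Cons.IH by simp
qed

text \<open>The induction starts from the end of \<open>u\<close>, as the word left of the head
  shrinks at its right end. The extra step bounces off the blank at cell -1.\<close>

lemma split_rewind_first:
  "(step split_tm ^^ (length u + 1)) (4, [a, left (zipper u v), c]) = (5, [a, zipper [] (u @ v), c])"
proof (induction u arbitrary: v rule: rev_induct)
  case Nil
  show ?case by (simp add: split_simps)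
next
  case (snoc x u)
  have 1: "step split_tm (4, [a, left (zipper (u @ [x]) v), c]) = (4, [a, left (zipper u (x # v)), c])"
    using act_left[of "zipper u (x # v)"] by (simp add: left_zipper split_simps del: act_left)
  have len: "length (u @ [x]) + 1 = Suc (length u + 1)" by simp
  show ?case
    unfolding len steps_Suc 1 snoc.IH by simp
qed

lemma split_rewind_second:
  "(step split_tm ^^ (length u + 1)) (5, [a, b, left (zipper u v)]) = (6, [a, b, zipper [] (u @ v)])"
proof (induction u arbitrary: v rule: rev_induct)
  case Nil
  show ?case by (simp add: split_simps)
next
  case (snoc x u)
  have 1: "step split_tm (5, [a, b, left (zipper (u @ [x]) v)]) = (5, [a, b, left (zipper u (x # v))])"
    using act_left[of "zipper u (x # v)"] by (simp add: left_zipper split_simps del: act_left)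
  have len: "length (u @ [x]) + 1 = Suc (length u + 1)" by simp
  show ?case
    unfolding len steps_Suc 1 snoc.IH by simp
qed

lemma split_run:
  "\<exists>a. halts_within split_tm
     [word_tape (True # encode_pair u v), word_tape [], word_tape []]
     [a, word_tape u, word_tape v] (3 * length u + 2 * length v + 5)"
proof -
  have "(step split_tm ^^ Suc 0) (0, [word_tape (True # encode_pair u v), word_tape [], word_tape []]) =
      (1, [zipper [True] (encode_pair u v), zipper [] [], zipper [] []])"
    by (simp add: word_tape_zipper split_simps)
  note steps_trans[OF this split_first]
  note steps_trans[OF this split_second]
  \<comment> \<open>Dropping the empty prefixes makes the rewinding times depend on
    \<open>length u\<close> and \<open>length v\<close>.\<close>
  note steps_trans[OF this, unfolded append_Nil, OF split_rewind_first]
  note run = steps_trans[OF this split_rewind_second]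
  have time: "Suc 0 + (2 * length u + 1) + (length v + 1) + (length u + 1) + (length v + 1) =
      3 * length u + 2 * length v + 5"
    by simp
  show ?thesis
    using run unfolding time unfolding halts_within_def states_glue word_tape_zipper append_Nil2
    by (rule exI)
qed

section \<open>Correctness of the joining machine\<close>

text \<open>Writing a marker leaves the head of tape 0 in place, so the bit is still there for the
  second step; the extra step writes the end marker.\<close>

lemma join_first:
  "(step join_tm ^^ (2 * length u + 1)) (1, [zipper p u, b, zipper r []]) =
     (3, [zipper (p @ u) [], b, zipper (r @ encode_pair u []) []])"
proof (induction u arbitrary: p r)
  case Nil
  show ?case by (simp add: join_simps)
next
  case (Cons x u)
  have "act (zipper p (x # u)) (sym x, Stay) = zipper p (x # u)"
    using act_stay[of "zipper p (x # u)"] by (simp del: act_stay)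
  then have 1: "step join_tm (1, [zipper p (x # u), b, zipper r []]) =
      (2, [zipper p (x # u), b, zipper (r @ [True]) []])"
    by (simp add: join_simps)
  have 2: "step join_tm (2, [zipper p (x # u), b, zipper (r @ [True]) []]) =
      (1, [zipper (p @ [x]) u, b, zipper (r @ [True, x]) []])"
    by (simp add: join_simps)
  have len: "2 * length (x # u) + 1 = Suc (Suc (2 * length u + 1))" by simp
  show ?case
    unfolding len steps_Suc 1 2 Cons.IH by simp
qed

lemma join_second:
  "(step join_tm ^^ (length v + 1)) (3, [a, zipper p v, zipper r []]) =
     (4, [a, zipper (p @ v) [], left (zipper (r @ v) [])])"
proof (induction v arbitrary: p r)
  case Nil
  show ?case by (simp add: join_simps)
next
  case (Cons x v)
  have 1: "step join_tm (3, [a, zipper p (x # v), zipper r []]) =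
      (3, [a, zipper (p @ [x]) v, zipper (r @ [x]) []])"
    by (simp add: join_simps)
  have len: "length (x # v) + 1 = Suc (length v + 1)" by simp
  show ?case
    unfolding len steps_Suc 1 Cons.IH by simp
qed

lemma join_rewind:
  "(step join_tm ^^ (length u + 1)) (4, [a, b, left (zipper u v)]) = (5, [a, b, zipper [] (u @ v)])"
proof (induction u arbitrary: v rule: rev_induct)
  case Nil
  show ?case by (simp add: join_simps)
next
  case (snoc x u)
  have 1: "step join_tm (4, [a, b, left (zipper (u @ [x]) v)]) = (4, [a, b, left (zipper u (x # v))])"
    using act_left[of "zipper u (x # v)"] by (simp add: left_zipper join_simps del: act_left)
  have len: "length (u @ [x]) + 1 = Suc (length u + 1)" by simp
  show ?case
    unfolding len steps_Suc 1 snoc.IH by simp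
qed

lemma join_run:
  "\<exists>a b. halts_within join_tm [word_tape u, word_tape v, word_tape []]
     [a, b, word_tape (True # encode_pair u v)] (4 * length u + 2 * length v + 6)"
proof -
  have "(step join_tm ^^ Suc 0) (0, [word_tape u, word_tape v, word_tape []]) =
      (1, [zipper [] u, zipper [] v, zipper [True] []])"
    by (simp add: word_tape_zipper join_simps)
  note steps_trans[OF this join_first]
  note steps_trans[OF this join_second]
  note run = steps_trans[OF this join_rewind]
  have out: "([True] @ encode_pair u []) @ v = True # encode_pair u v"
    using encode_pair_append[of u v] by simp
  \<comment> \<open>The rewind crosses the whole output, of length
    \<open>2 * length u + length v + 2\<close>; this brings the coefficient of
    \<open>length u\<close> to 4.\<close>
  have time: "Suc 0 + (2 * length u + 1) + (length v + 1) + (length (True # encode_pair u v) + 1) =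
      4 * length u + 2 * length v + 6"
    by (simp add: length_encode_pair)
  show ?thesis
    using run unfolding out time unfolding halts_within_def states_glue word_tape_zipper append_Nil2
    by (intro exI)
qed

section \<open>Functions applied to both components of a pair\<close>

lemma valid_word_tapes:
  "3 \<le> alphabet M \<Longrightarrow> length ws = tapes M \<Longrightarrow> valid_tapes M (map word_tape ws)"
  by (auto simp: valid_tapes_def word_tape_def)

text \<open>
  Tape 0 holds the pair, which is split onto tapes 2 and 3; the machines of \<open>f\<close> and \<open>g\<close> leave
  their outputs on tapes 4 and 5, from where they are joined onto tape 1.
\<close>

lemma polytime_map_prod:
  assumes "polytime e\<^sub>1 e\<^sub>1' D\<^sub>1 f" "polytime e\<^sub>2 e\<^sub>2' D\<^sub>2 g"
  shows "polytime (\<lambda>(x, y). True # encode_pair (e\<^sub>1 x) (e\<^sub>2 y))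
    (\<lambda>(x, y). True # encode_pair (e\<^sub>1' x) (e\<^sub>2' y)) (D\<^sub>1 \<times> D\<^sub>2) (map_prod f g)"
proof -
  obtain M p where M: "wf_tm M"
    and runM: "\<And>x. x \<in> D\<^sub>1 \<Longrightarrow> outputs_within M (e\<^sub>1 x) (e\<^sub>1' (f x)) (poly p (length (e\<^sub>1 x)))"
    using assms(1) unfolding polytime_def by blast
  obtain N r where N: "wf_tm N"
    and runN: "\<And>x. x \<in> D\<^sub>2 \<Longrightarrow> outputs_within N (e\<^sub>2 x) (e\<^sub>2' (g x)) (poly r (length (e\<^sub>2 x)))"
    using assms(2) unfolding polytime_def by blast
  let ?A = "max (alphabet M) (alphabet N)"
  \<comment> \<open>Tapes 0 to 5, plus \<open>tapes M - 2\<close> and \<open>tapes N - 2\<close>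
    scratch tapes.\<close>
  let ?k = "tapes M + tapes N + 2"
  let ?js = "[6..<tapes M + 4]" and ?js' = "[tapes M + 4..<?k]"
  let ?is = "2 # 4 # ?js" and ?is' = "3 # 5 # ?js'"
  let ?S = "lift_tm ?A ?k [0, 2, 3] split_tm" and ?M = "lift_tm ?A ?k ?is M"
    and ?N = "lift_tm ?A ?k ?is' N" and ?J = "lift_tm ?A ?k [4, 5, 1] join_tm"
  let ?T = "seq_tm (seq_tm (seq_tm ?S ?M) ?N) ?J"
  have ge: "tapes M \<ge> 2" "tapes N \<ge> 2" "?A \<ge> 3" using M N by (auto simp: wf_tm_def)
  have I: "length ?is = tapes M" "distinct ?is" "set ?is \<subseteq> {..<?k}" using ge by auto
  have I': "length ?is' = tapes N" "distinct ?is'" "set ?is' \<subseteq> {..<?k}" using ge by auto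
  have S: "length [0, 2, 3] = tapes split_tm" "distinct [0, 2, 3 :: nat]" "set [0, 2, 3] \<subseteq> {..<?k}"
    using ge by auto
  have J: "length [4, 5, 1] = tapes join_tm" "distinct [4, 5, 1 :: nat]" "set [4, 5, 1] \<subseteq> {..<?k}"
    using ge by auto
  have wf: "wf_tm ?T"
    using wf_lift_tm[OF M I] wf_lift_tm[OF N I'] wf_lift_tm[OF wf_split_tm S]
      wf_lift_tm[OF wf_join_tm J] ge(3)
    by (intro wf_seq_tm) auto
  \<comment> \<open>The first \<open>p + r\<close> pays for \<open>M\<close> and \<open>N\<close>.
    Joining costs at most \<open>4 * p + 2 * r + 6\<close>, as outputs are no longer than running
    times, and splitting at most \<open>5 * n + 5\<close> on input length \<open>n\<close>.\<close>
  let ?P = "p + r + 4 * p + 2 * r + [:11, 5:]"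
  have "outputs_within ?T (True # encode_pair (e\<^sub>1 x) (e\<^sub>2 y)) (True # encode_pair (e\<^sub>1' (f x)) (e\<^sub>2' (g y)))
      (poly ?P (length (True # encode_pair (e\<^sub>1 x) (e\<^sub>2 y))))" if x: "x \<in> D\<^sub>1" and y: "y \<in> D\<^sub>2" for x y
  proof -
    let ?w = "True # encode_pair (e\<^sub>1 x) (e\<^sub>2 y)"
    let ?ts = "word_tape ?w # replicate (?k - 1) (word_tape [])"
    let ?t = "poly p (length (e\<^sub>1 x))" and ?u = "poly r (length (e\<^sub>2 y))"
    let ?s = "3 * length (e\<^sub>1 x) + 2 * length (e\<^sub>2 y) + 5"
    let ?j = "4 * length (e\<^sub>1' (f x)) + 2 * length (e\<^sub>2' (g y)) + 6"
    have lts: "length ?ts = ?k" using ge by simp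
    have blank: "?ts ! j = word_tape []" if "j \<ge> 1" "j < ?k" for j
      using that by (simp add: nth_Cons')
    have in_S: "map ((!) ?ts) [0, 2, 3] = [word_tape ?w, word_tape [], word_tape []]"
      using ge by (simp add: nth_Cons')
    have valid_S: "valid_tapes split_tm (map ((!) ?ts) [0, 2, 3])"
      unfolding in_S using valid_word_tapes[of split_tm "[?w, [], []]"] by simp
    obtain a where "halts_within split_tm (map ((!) ?ts) [0, 2, 3]) [a, word_tape (e\<^sub>1 x), word_tape (e\<^sub>2 y)] ?s"
      using split_run unfolding in_S by blast
    from halts_within_lift[OF wf_split_tm S lts valid_S this] obtain ts1 where
      1: "halts_within ?S ?ts ts1 ?s" "map ((!) ts1) [0, 2, 3] = [a, word_tape (e\<^sub>1 x), word_tape (e\<^sub>2 y)]"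
        "length ts1 = ?k" "\<And>j. j < ?k \<Longrightarrow> j \<notin> set [0, 2, 3] \<Longrightarrow> ts1 ! j = ?ts ! j"
      by metis
    have blank1: "ts1 ! j = word_tape []" if "j \<ge> 1" "j < ?k" "j \<noteq> 2" "j \<noteq> 3" for j
      using that 1(4) blank by simp
    obtain ts2 where 2: "halts_within ?M ts1 ts2 ?t" "ts2 ! 4 = word_tape (e\<^sub>1' (f x))"
      "length ts2 = ?k" "\<And>j. j < ?k \<Longrightarrow> j \<notin> set ?is \<Longrightarrow> ts2 ! j = ts1 ! j"
    proof (rule outputs_within_lift[OF M I(1) refl I(2,3) 1(3) _ _ _ runM[OF x], where A = ?A])
      show "ts1 ! 2 = word_tape (e\<^sub>1 x)" using 1(2) by simp
      show "ts1 ! 4 = word_tape []" using ge by (intro blank1) auto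
      show "ts1 ! j = word_tape []" if "j \<in> set ?js" for j
        using that ge by (intro blank1) auto
    qed blast
    \<comment> \<open>These tapes lie outside the block of \<open>M\<close> and were not touched by
      the split either.\<close>
    have blank2: "ts2 ! j = word_tape []" if "j = 1 \<or> j = 5 \<or> j \<in> set ?js'" for j
    proof -
      have "ts2 ! j = ts1 ! j" using that ge by (intro 2(4)) auto
      also have "\<dots> = word_tape []" using that ge by (intro blank1) auto
      finally show ?thesis .
    qed
    obtain ts3 where 3: "halts_within ?N ts2 ts3 ?u" "ts3 ! 5 = word_tape (e\<^sub>2' (g y))"
      "length ts3 = ?k" "\<And>j. j < ?k \<Longrightarrow> j \<notin> set ?is' \<Longrightarrow> ts3 ! j = ts2 ! j"
    proof (rule outputs_within_lift[OF N I'(1) refl I'(2,3) 2(3) _ _ _ runN[OF y], where A = ?A])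
      have "ts2 ! 3 = ts1 ! 3" using ge by (intro 2(4)) auto
      then show "ts2 ! 3 = word_tape (e\<^sub>2 y)" using 1(2) by simp
      show "ts2 ! 5 = word_tape []" by (intro blank2) auto
      show "ts2 ! j = word_tape []" if "j \<in> set ?js'" for j
        using that by (intro blank2) auto
    qed blast
    \<comment> \<open>\<open>N\<close> works on tapes 3, 5 and its own scratch tapes, so the output
      of \<open>M\<close> and the blank tape 1 survive.\<close>
    have "ts3 ! 4 = ts2 ! 4" "ts3 ! 1 = ts2 ! 1" using ge by (intro 3(4); auto)+
    then have in_J: "map ((!) ts3) [4, 5, 1] = [word_tape (e\<^sub>1' (f x)), word_tape (e\<^sub>2' (g y)), word_tape []]"
      using 2(2) 3(2) blank2[of 1] by simp
    have valid_J: "valid_tapes join_tm (map ((!) ts3) [4, 5, 1])"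
      unfolding in_J using valid_word_tapes[of join_tm "[e\<^sub>1' (f x), e\<^sub>2' (g y), []]"] by simp
    obtain b c where "halts_within join_tm (map ((!) ts3) [4, 5, 1])
        [b, c, word_tape (True # encode_pair (e\<^sub>1' (f x)) (e\<^sub>2' (g y)))] ?j"
      using join_run unfolding in_J by blast
    from halts_within_lift[OF wf_join_tm J 3(3) valid_J this] obtain ts4 where
      4: "halts_within ?J ts3 ts4 ?j"
        "map ((!) ts4) [4, 5, 1] = [b, c, word_tape (True # encode_pair (e\<^sub>1' (f x)) (e\<^sub>2' (g y)))]"
      by metis
    have "outputs_within ?T ?w (True # encode_pair (e\<^sub>1' (f x)) (e\<^sub>2' (g y))) (?s + ?t + ?u + ?j)"
      unfolding outputs_within_iff
      using halts_within_seq[OF halts_within_seq[OF halts_within_seq[OF 1(1) 2(1)] 3(1)] 4(1)] 4(2)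
      by auto
    moreover have "?s + ?t + ?u + ?j \<le> poly ?P (length ?w)"
    proof -
      have "?t \<le> poly p (length ?w)" "?u \<le> poly r (length ?w)"
        by (rule poly_nat_mono, simp add: length_encode_pair)+
      moreover have "length (e\<^sub>1' (f x)) \<le> ?t" "length (e\<^sub>2' (g y)) \<le> ?u"
        using output_length[OF M runM[OF x]] output_length[OF N runN[OF y]] .
      moreover have "?s \<le> 5 * length ?w + 5" by (simp add: length_encode_pair)
      moreover have "poly ?P n = poly p n + poly r n + 4 * poly p n + 2 * poly r n + (5 * n + 11)" for n
        by simp
      note this[of "length ?w"]
      ultimately show ?thesis by linarith
    qed
    ultimately show ?thesis by (rule outputs_within_mono)
  qed
  then show ?thesis
    using wf unfolding polytime_def by (intro exI[of _ ?T] exI[of _ ?P]) auto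
qed

section \<open>Transfer along the isomorphism\<close>

text \<open>A machine sees only codes. This lets the constructor \<open>Witness\<close> be removed
  and restored without changing the machine.\<close>

lemma polytime_encode_cong:
  assumes "polytime e e' D f" "\<And>x. x \<in> D \<Longrightarrow> e' (f x) = e'' (g x)"
  shows "polytime e e'' D g"
  using assms unfolding polytime_def by simp

theorem theorem16:
  fixes P :: "('i, 's) problem" and P' :: "('j, 't) problem"
    and \<phi> :: "'i \<Rightarrow> 'j" and \<psi> :: "'t answer \<Rightarrow> 's answer"
    and dist :: "'i \<Rightarrow> 'i \<Rightarrow> real" and dist' :: "'j \<Rightarrow> 'j \<Rightarrow> real"
    and d :: "nat \<Rightarrow> ennreal"
  assumes "problem P" and "problem P'"
    and "polytime_isomorphism P P' \<phi> \<psi>"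
    and "length_preserving P P' \<phi>"
    and "Metric_space (inputs P) dist"
    and "Metric_space (inputs P') dist'"
    and "\<And>I J. I \<in> inputs P \<Longrightarrow> J \<in> inputs P \<Longrightarrow> dist I J = dist' (\<phi> I) (\<phi> J)"
    and "mono d"
    and "in_FP (Rel P' dist' d)"
  shows "in_FP (Rel P dist d)"
proof -
  let ?\<chi> = "inv_into (inputs P) \<phi>" and ?A = "\<Union>J\<in>inputs P'. sol P' J"
  have bij: "bij_betw \<phi> (inputs P) (inputs P')"
    and poly_\<phi>: "polytime (encode_input P) (encode_input P') (inputs P) \<phi>"
    and poly_\<chi>: "polytime (encode_input P') (encode_input P) (inputs P') ?\<chi>"
    and poly_\<psi>: "polytime (encode_answer P') (encode_answer P) ?A \<psi>"
    and \<psi>: "\<And>I x. I \<in> inputs P \<Longrightarrow> x \<in> sol P' (\<phi> I) \<Longrightarrow> \<psi> x \<in> sol P I"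
    using assms(3) unfolding polytime_isomorphism_def by auto
  obtain h where poly_h: "polytime (encode_input P') (encode_answer (Rel P' dist' d)) (inputs P') h"
    and h: "\<And>I. I \<in> inputs P' \<Longrightarrow> h I \<in> sol (Rel P' dist' d) I"
    using assms(9) unfolding in_FP_def by (auto simp: Rel_def)
  \<comment> \<open>Solutions of the relaxed problem are always witnesses, so the missing cases
    never occur on \<open>inputs P'\<close>.\<close>
  define w where "w I = (case h I of Witness s \<Rightarrow> s)" for I
  have w: "h I = Witness (w I)" "fst (w I) \<in> inputs P'" "snd (w I) \<in> sol P' (fst (w I))"
    "ennreal (dist' I (fst (w I))) \<le> d (input_size P' I)" if "I \<in> inputs P'" for I
    using h[OF that] by (auto simp: Rel_def w_def)
  define F where "F = map_prod ?\<chi> \<psi> \<circ> (w \<circ> \<phi>)"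
  \<comment> \<open>The leading \<open>True\<close> is the tag by which \<open>encode_answer\<close>
    marks a witness.\<close>
  have "polytime (encode_input P') (\<lambda>(J, a). True # encode_pair (encode_input P' J) (encode_answer P' a))
      (inputs P') w"
    using poly_h by (rule polytime_encode_cong) (simp add: w(1) Rel_def split: prod.splits)
  with poly_\<phi> have "polytime (encode_input P)
      (\<lambda>(J, a). True # encode_pair (encode_input P' J) (encode_answer P' a)) (inputs P) (w \<circ> \<phi>)"
    by (rule polytime_comp) (use bij in \<open>simp add: bij_betw_def\<close>)
  then have "polytime (encode_input P)
      (\<lambda>(J, a). True # encode_pair (encode_input P J) (encode_answer P a)) (inputs P) F"
    unfolding F_def
  proof (rule polytime_comp[OF _ polytime_map_prod[OF poly_\<chi> poly_\<psi>]])
    \<comment> \<open>The polynomial bound for \<open>\<psi>\<close> covers the solutions of all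
      inputs of \<open>P'\<close>; this suffices as the returned answer may belong to an input other
      than \<open>\<phi> I\<close>.\<close>
    have "w (\<phi> I) \<in> inputs P' \<times> ?A" if "I \<in> inputs P" for I
      using w(2,3)[of "\<phi> I"] bij_betwE[OF bij] that unfolding mem_Times_iff by blast
    then show "(w \<circ> \<phi>) ` inputs P \<subseteq> inputs P' \<times> ?A"
      by (intro image_subsetI) (simp only: comp_apply)
  qed
  then have "polytime (encode_input (Rel P dist d)) (encode_answer (Rel P dist d))
      (inputs (Rel P dist d)) (Witness \<circ> F)"
    by (simp add: Rel_def comp_def) (erule polytime_encode_cong, simp split: prod.splits)
  moreover have "(Witness \<circ> F) I \<in> sol (Rel P dist d) I" if "I \<in> inputs (Rel P dist d)" for I
  proof -
    have I: "I \<in> inputs P" "\<phi> I \<in> inputs P'"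
      using that bij_betwE[OF bij] by (auto simp: Rel_def)
    let ?J = "?\<chi> (fst (w (\<phi> I)))"
    have J: "?J \<in> inputs P" "\<phi> ?J = fst (w (\<phi> I))"
      using bij w(2)[OF I(2)] by (simp_all add: bij_betw_def inv_into_into f_inv_into_f)
    have "F I = (?J, \<psi> (snd (w (\<phi> I))))"
      by (simp add: F_def map_prod_def split: prod.splits)
    \<comment> \<open>The answer solves \<open>P'\<close> at \<open>\<phi> ?J\<close>, so its
      pullback is a solution at \<open>?J\<close> rather than at \<open>I\<close>.\<close>
    moreover have "\<psi> (snd (w (\<phi> I))) \<in> sol P ?J"
      using \<psi>[OF J(1)] w(3)[OF I(2)] J(2) by simp
    \<comment> \<open>The isometry turns the distance between the images into
      \<open>dist I ?J\<close>, and length preservation identifies the arguments of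
      \<open>d\<close>.\<close>
    moreover have "ennreal (dist I ?J) \<le> d (input_size P I)"
      using w(4)[OF I(2)] assms(4,7) I(1) J by (simp add: length_preserving_def)
    ultimately show ?thesis using J(1) by (simp add: Rel_def)
  qed
  ultimately show ?thesis
    unfolding in_FP_def using function_problem_Rel[OF assms(1,5)] by blast
qed

end
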